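(* Let $f:\mathbb{R}^d\to\mathbb{R}$ be differentiable with $\|\nabla f(x)-\nabla f(y)\|_2\le L\|x-y\|_2$ for all $x,y$, let $r:\mathbb{R}^d\to\mathbb{R}\cup\{+\infty\}$ be convex, and let $F=f+r$ have non-empty solution set $\mathcal{X}^\star=\{x^\star:F(x^\star)=\min_xF(x)\}$. Suppose $F$ is coercive (for any sequence $\{v_k\}$, $\lim_k\|v_k-\mathrm{P}_\star(v_k)\|_2=+\infty$ implies $\lim_kF(v_k)=+\infty$) and $\partial F$ is coercive with respect to $F$ (for any sequence $\{v_k\}$, $\lim_kF(v_k)=+\infty$ implies $\lim_k\inf_{u\in\partial F(v_k)}\|u\|_2=+\infty$). Let $x_{k+1}=\mathrm{prox}_{\alpha r}(x_k-\alpha\hat g_k)$ with $\alpha=1/L$, and suppose $\|\nabla f(x_k)-\hat g_k\|_2^2\le\varepsilon_{\mathrm{abs}}$ for all $k$. Then there exists $R>0$ such that $\|x_k-\mathrm{P}_\star(x_k)\|_2\le R$ for all $k$.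
   Context: $\mathrm{prox}_{\alpha r}(x)=\mathrm{argmin}_{y\in\mathbb{R}^d}\frac12\|x-y\|_2^2+\alpha r(y)$. $\mathrm{P}_\star(x)$ is a nearest point to $x$ in $\mathcal{X}^\star$, so $\|x-\mathrm{P}_\star(x)\|_2$ is the distance from $x$ to $\mathcal{X}^\star$. $\partial F(x)=\nabla f(x)+\partial r(x)$, where $\partial r$ is the convex subdifferential. $\varepsilon_{\mathrm{abs}}\ge0$ is a fixed constant independent of $k$. The initial point $x_0$ satisfies $F(x_0)<+\infty$. *)

theory Defs
  imports "HOL-Analysis.Analysis"
begin

text \<open>
  Functions into the reals extended by plus infinity are functions into \<^typ>\<open>ereal\<close>
  that never take the value \<^term>\<open>-\<infinity> :: ereal\<close>; that side condition is part of
  the convexity predicate below.  In \<^typ>\<open>ereal\<close> one has \<open>0 * \<infinity> = 0\<close>, so the end points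
  \<open>t = 0\<close> and \<open>t = 1\<close> of the convexity inequality are harmless.
\<close>

definition ext_convex :: "('a::real_vector \<Rightarrow> ereal) \<Rightarrow> bool" where
  "ext_convex r \<longleftrightarrow>
     (\<forall>x. r x \<noteq> -\<infinity>) \<and>
     (\<forall>x y. \<forall>t\<in>{0..1}. r ((1 - t) *\<^sub>R x + t *\<^sub>R y) \<le> ereal (1 - t) * r x + ereal t * r y)"

text \<open>If \<open>r\<close> is finite somewhere, this set is empty at every \<open>x\<close> with \<open>r x = \<infinity>\<close>.\<close>

definition subdiff :: "('a::real_inner \<Rightarrow> ereal) \<Rightarrow> 'a \<Rightarrow> 'a set" where
  "subdiff r x = {u. \<forall>y. r x + ereal (u \<bullet> (y - x)) \<le> r y}"

definition composite :: "('a \<Rightarrow> real) \<Rightarrow> ('a \<Rightarrow> ereal) \<Rightarrow> 'a \<Rightarrow> ereal" where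
  "composite f r x = ereal (f x) + r x"

definition composite_subdiff ::
  "('a \<Rightarrow> 'a) \<Rightarrow> ('a::real_inner \<Rightarrow> ereal) \<Rightarrow> 'a \<Rightarrow> 'a set" where
  "composite_subdiff gradf r x = {gradf x + u | u. u \<in> subdiff r x}"

definition solution_set :: "('a \<Rightarrow> ereal) \<Rightarrow> 'a set" where
  "solution_set F = {x. is_arg_min F (\<lambda>_. True) x}"

definition nearest_point_map :: "'a::real_normed_vector set \<Rightarrow> ('a \<Rightarrow> 'a) \<Rightarrow> bool" where
  "nearest_point_map X P \<longleftrightarrow> (\<forall>x. is_arg_min (\<lambda>p. norm (x - p)) (\<lambda>p. p \<in> X) (P x))"

text \<open>
  The proximal step is a relation, because a convex function that is not assumed lower
  semicontinuous need not have a proximal point.  By strong convexity there is at most one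
  when \<open>\<alpha> > 0\<close> and \<open>r\<close> is convex and somewhere finite.
\<close>

definition is_prox :: "real \<Rightarrow> ('a::real_normed_vector \<Rightarrow> ereal) \<Rightarrow> 'a \<Rightarrow> 'a \<Rightarrow> bool" where
  "is_prox \<alpha> r x p \<longleftrightarrow>
     is_arg_min (\<lambda>y. ereal (1 / 2 * (norm (x - y))\<^sup>2) + ereal \<alpha> * r y) (\<lambda>_. True) p"

definition coercive_wrt :: "('a::real_normed_vector \<Rightarrow> 'a) \<Rightarrow> ('a \<Rightarrow> ereal) \<Rightarrow> bool" where
  "coercive_wrt P F \<longleftrightarrow>
     (\<forall>v :: nat \<Rightarrow> 'a. filterlim (\<lambda>k. norm (v k - P (v k))) at_top sequentially
        \<longrightarrow> (\<lambda>k. F (v k)) \<longlonglongrightarrow> \<infinity>)"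

text \<open>
  The infimum is taken in \<^typ>\<open>ereal\<close>, so it is \<open>\<infinity>\<close> at points where the subdifferential
  is empty.
\<close>

definition subdiff_coercive ::
  "('a::real_normed_vector \<Rightarrow> 'a set) \<Rightarrow> ('a \<Rightarrow> ereal) \<Rightarrow> bool" where
  "subdiff_coercive dF F \<longleftrightarrow>
     (\<forall>v :: nat \<Rightarrow> 'a. (\<lambda>k. F (v k)) \<longlonglongrightarrow> \<infinity>
        \<longrightarrow> (\<lambda>k. INF u\<in>dF (v k). ereal (norm u)) \<longlonglongrightarrow> \<infinity>)"

end

theory Submission
  imports Defs
begin

text \<open>
  The objective cannot grow beyond a fixed level, although single steps may increase it.  Write
  \<open>d = x (Suc k) - x k\<close> and \<open>e\<close> for the gradient error, so that \<open>norm e \<le> s\<close> for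
  \<open>s = sqrt \<epsilon>_abs\<close>.  Optimality of the proximal step puts \<open>- L d - g k\<close> into the subdifferential
  of \<open>r\<close> at \<open>x (Suc k)\<close> (\<open>prox_residual_in_subdiff\<close>).  This one subgradient is used twice.

  Testing it at \<open>x k\<close> and adding the quadratic upper bound for \<open>f\<close> (\<open>descent_inequality\<close>) gives
  \<open>F (x (Suc k)) \<le> F (x k) + e \<bullet> d - L / 2 * (norm d)\<^sup>2\<close>, so a step with \<open>L * norm d \<ge> 2 * s\<close>
  does not increase \<open>F\<close>.  Adding the gradient of \<open>f\<close> at \<open>x (Suc k)\<close> instead gives an
  element of the subdifferential of \<open>F\<close> there, of norm at most \<open>2 * L * norm d + s\<close>.  So a step with
  \<open>L * norm d < 2 * s\<close> ends at a point with a subgradient of norm at most \<open>5 * s\<close>.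
  Coercivity of the subdifferential bounds \<open>F\<close> on the set of all such points by some \<open>M\<close>
  (\<open>subdiff_coercive_imp_bounded_value\<close>).

  Every step therefore either does not increase \<open>F\<close> or lands in the sublevel set of \<open>M\<close>.  Hence
  the iterates stay in the sublevel set of the maximum of \<open>F (x 0)\<close> and \<open>M\<close>, and coercivity
  of \<open>F\<close> bounds the distance to the solutions on it (\<open>coercive_wrt_imp_bounded_distance\<close>).
\<close>

text \<open>
  Along the segment from \<open>a\<close> to \<open>b\<close>, the gap between \<open>f\<close> and the quadratic upper model has
  derivative at most \<open>0\<close>, by Cauchy-Schwarz and the Lipschitz bound.
\<close>

lemma descent_inequality:
  fixes f :: "'a::real_inner \<Rightarrow> real"
  assumes grad: "\<And>z. GDERIV f z :> gradf z"
    and lip: "\<And>y z. norm (gradf y - gradf z) \<le> L * norm (y - z)"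
  shows "f b \<le> f a + gradf a \<bullet> (b - a) + L / 2 * (norm (b - a))\<^sup>2"
proof -
  define d where "d = b - a"
  define \<phi> where "\<phi> t = f (a + t *\<^sub>R d) - t * (gradf a \<bullet> d) - L / 2 * t\<^sup>2 * (norm d)\<^sup>2" for t :: real
  have "\<phi> 1 \<le> \<phi> 0"
  proof (rule DERIV_nonpos_imp_nonincreasing[where f = \<phi>])
    fix t :: real assume t: "0 \<le> t" "t \<le> 1"
    let ?z = "a + t *\<^sub>R d"
    have "((\<lambda>t. f (a + t *\<^sub>R d)) has_derivative (\<lambda>h. (h *\<^sub>R d) \<bullet> gradf ?z)) (at t)"
      by (rule has_derivative_compose[of "\<lambda>t. a + t *\<^sub>R d" "\<lambda>h. h *\<^sub>R d",
            OF _ grad[of ?z, unfolded gderiv_def]]) (auto intro!: derivative_eq_intros)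
    then have "((\<lambda>t. f (a + t *\<^sub>R d)) has_real_derivative gradf ?z \<bullet> d) (at t)"
      by (rule has_derivative_imp_has_field_derivative) (simp add: inner_commute)
    then have "(\<phi> has_real_derivative
        (gradf ?z \<bullet> d - gradf a \<bullet> d - L / 2 * (2 * t) * (norm d)\<^sup>2)) (at t)"
      unfolding \<phi>_def by (auto intro!: derivative_eq_intros)
    moreover have "gradf ?z \<bullet> d - gradf a \<bullet> d \<le> L * t * (norm d)\<^sup>2"
    proof -
      have "(gradf ?z - gradf a) \<bullet> d \<le> norm (gradf ?z - gradf a) * norm d"
        by (rule norm_cauchy_schwarz)
      also have "\<dots> \<le> (L * norm (?z - a)) * norm d"
        by (intro mult_right_mono lip norm_ge_zero)
      also have "\<dots> = L * t * (norm d)\<^sup>2"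
        using t by (simp add: power2_eq_square)
      finally show ?thesis by (simp add: inner_diff_left)
    qed
    ultimately show "\<exists>y. (\<phi> has_real_derivative y) (at t) \<and> y \<le> 0"
      by (intro exI[of _ "gradf ?z \<bullet> d - gradf a \<bullet> d - L / 2 * (2 * t) * (norm d)\<^sup>2"] conjI) auto
  qed simp
  then show ?thesis by (simp add: \<phi>_def d_def algebra_simps)
qed

lemma is_prox_finite:
  assumes "ext_convex r" "0 < \<alpha>" "is_prox \<alpha> r w p" "r z < \<infinity>"
  shows "\<bar>r p\<bar> \<noteq> \<infinity>"
proof -
  have "ereal (1 / 2 * (norm (w - p))\<^sup>2) + ereal \<alpha> * r p
      \<le> ereal (1 / 2 * (norm (w - z))\<^sup>2) + ereal \<alpha> * r z"
    using assms(3) by (simp add: is_prox_def is_arg_min_linorder)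
  moreover have "r z \<noteq> -\<infinity>" "r p \<noteq> -\<infinity>"
    using assms(1) by (auto simp: ext_convex_def)
  ultimately show ?thesis
    using assms(2,4) by (cases "r z"; cases "r p") auto
qed

text \<open>
  Comparing \<open>p\<close> with \<open>p + t *\<^sub>R (y - p)\<close> in the proximal objective, the quadratic term contributes
  the wanted linear term and an error of order \<open>t\<^sup>2\<close>.  After division by \<open>t\<close> the error vanishes
  as \<open>t\<close> tends to \<open>0\<close>.
\<close>

lemma prox_residual_in_subdiff:
  fixes r :: "'a::real_inner \<Rightarrow> ereal"
  assumes conv: "ext_convex r" and \<alpha>: "0 < \<alpha>" and prox: "is_prox \<alpha> r w p" and z: "r z < \<infinity>"
  shows "(1 / \<alpha>) *\<^sub>R (w - p) \<in> subdiff r p"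
proof -
  obtain rp where rp: "r p = ereal rp"
    using is_prox_finite[OF assms] by auto
  have "ereal rp + ereal ((1 / \<alpha>) *\<^sub>R (w - p) \<bullet> (y - p)) \<le> r y" for y
  proof (cases "r y")
    case (real ry)
    let ?q = "(w - p) \<bullet> (y - p)"
    have ineq: "?q - t / 2 * (norm (y - p))\<^sup>2 \<le> \<alpha> * (ry - rp)" if t: "0 < t" "t \<le> 1" for t
    proof -
      let ?m = "(1 - t) *\<^sub>R p + t *\<^sub>R y"
      have rm: "r ?m \<le> ereal ((1 - t) * rp + t * ry)"
      proof -
        have "r ?m \<le> ereal (1 - t) * r p + ereal t * r y"
          using conv t unfolding ext_convex_def by (metis atLeastAtMost_iff less_imp_le)
        then show ?thesis by (simp add: rp real)
      qed
      have "ereal (1 / 2 * (norm (w - p))\<^sup>2) + ereal \<alpha> * r p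
          \<le> ereal (1 / 2 * (norm (w - ?m))\<^sup>2) + ereal \<alpha> * r ?m"
        using prox by (simp add: is_prox_def is_arg_min_linorder)
      also have "\<dots> \<le> ereal (1 / 2 * (norm (w - ?m))\<^sup>2) + ereal \<alpha> * ereal ((1 - t) * rp + t * ry)"
        using \<alpha> by (intro add_left_mono ereal_mult_left_mono rm) auto
      finally have le: "1 / 2 * (norm (w - p))\<^sup>2 + \<alpha> * rp
          \<le> 1 / 2 * (norm (w - ?m))\<^sup>2 + \<alpha> * ((1 - t) * rp + t * ry)"
        by (simp add: rp)
      have "w - ?m = (w - p) - t *\<^sub>R (y - p)"
        by (simp add: algebra_simps)
      then have "(norm (w - ?m))\<^sup>2 = (norm (w - p))\<^sup>2 - 2 * t * ?q + t\<^sup>2 * (norm (y - p))\<^sup>2"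
        by (simp only: power2_norm_eq_inner inner_diff_left[of "w - p"] inner_diff_right[of _ "w - p"]
              inner_scaleR_left inner_scaleR_right inner_commute[of "y - p" "w - p"])
          (simp add: power2_eq_square algebra_simps)
      with le have "t * (?q - t / 2 * (norm (y - p))\<^sup>2) \<le> t * (\<alpha> * (ry - rp))"
        by (simp add: field_simps power2_eq_square)
      then show ?thesis using t by simp
    qed
    have "?q - 0 / 2 * (norm (y - p))\<^sup>2 \<le> \<alpha> * (ry - rp)"
    proof (rule tendsto_upperbound)
      show "((\<lambda>t. ?q - t / 2 * (norm (y - p))\<^sup>2) \<longlongrightarrow> ?q - 0 / 2 * (norm (y - p))\<^sup>2) (at_right 0)"
        by (intro tendsto_intros) simp
      show "\<forall>\<^sub>F t in at_right 0. ?q - t / 2 * (norm (y - p))\<^sup>2 \<le> \<alpha> * (ry - rp)"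
        using ineq unfolding eventually_at_right_field by (intro exI[of _ 1]) auto
    qed simp
    then have "?q / \<alpha> \<le> ry - rp"
      using \<alpha> by (simp add: pos_divide_le_eq mult.commute)
    then show ?thesis by (simp add: real)
  next
    case MInf
    then show ?thesis using conv by (auto simp: ext_convex_def)
  qed simp
  then show ?thesis by (simp add: subdiff_def rp)
qed

text \<open>
  Coercivity speaks about sequences, but the argument needs one bound for all points.  If there
  were none, points whose values exceed \<open>0, 1, 2, \<dots>\<close> would form a sequence along which \<open>F\<close>
  tends to \<open>\<infinity>\<close> while \<open>B\<close> still bounds the norm of some subgradient.
\<close>

lemma subdiff_coercive_imp_bounded_value:
  assumes "subdiff_coercive dF F"
  shows "\<exists>M. \<forall>v. (\<exists>u\<in>dF v. norm u \<le> B) \<longrightarrow> F v \<le> ereal M"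
proof (rule ccontr)
  assume "\<not> ?thesis"
  then have "\<forall>n. \<exists>v. (\<exists>u\<in>dF v. norm u \<le> B) \<and> \<not> F v \<le> ereal (real n)"
    by blast
  then obtain v where v: "\<And>n. \<exists>u\<in>dF (v n). norm u \<le> B" "\<And>n. ereal (real n) < F (v n)"
    unfolding not_le by metis
  have "(\<lambda>n. F (v n)) \<longlonglongrightarrow> \<infinity>"
    unfolding tendsto_PInfty
  proof
    fix c :: real
    obtain N where "c < real N" using reals_Archimedean2 by blast
    then have "ereal c < F (v n)" if "N \<le> n" for n
      using v(2)[of n] that less_trans[of "ereal c" "ereal (real n)" "F (v n)"] by simp
    then show "\<forall>\<^sub>F n in sequentially. ereal c < F (v n)"
      by (auto simp: eventually_sequentially)
  qed
  then have "(\<lambda>n. INF u\<in>dF (v n). ereal (norm u)) \<longlonglongrightarrow> \<infinity>"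
    using assms by (simp add: subdiff_coercive_def)
  then obtain n where "ereal B < (INF u\<in>dF (v n). ereal (norm u))"
    unfolding tendsto_PInfty eventually_sequentially by blast
  moreover obtain u where "u \<in> dF (v n)" "norm u \<le> B"
    using v(1) by blast
  ultimately show False
    using INF_lower[of u "dF (v n)" "\<lambda>u. ereal (norm u)"]
    by (meson ereal_less_eq(3) leD order.strict_trans2)
qed

lemma coercive_wrt_imp_bounded_distance:
  assumes "coercive_wrt P F"
  shows "\<exists>R>0. \<forall>v. F v \<le> ereal M \<longrightarrow> norm (v - P v) \<le> R"
proof (rule ccontr)
  assume *: "\<not> ?thesis"
  have "\<exists>v. F v \<le> ereal M \<and> real (Suc n) < norm (v - P v)" for n
    using *[unfolded not_ex, rule_format, of "real (Suc n)"] by (auto simp: not_le)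
  then obtain v where v: "\<And>n. F (v n) \<le> ereal M" "\<And>n. real (Suc n) < norm (v n - P (v n))"
    by metis
  have "filterlim (\<lambda>n. norm (v n - P (v n))) at_top sequentially"
  proof (rule filterlim_at_top_mono[OF filterlim_real_sequentially])
    show "\<forall>\<^sub>F n in sequentially. real n \<le> norm (v n - P (v n))"
    proof (intro always_eventually allI)
      show "real n \<le> norm (v n - P (v n))" for n
        using v(2)[of n] by simp
    qed
  qed
  then have "(\<lambda>n. F (v n)) \<longlonglongrightarrow> \<infinity>"
    using assms by (simp add: coercive_wrt_def)
  then obtain n where "ereal M < F (v n)"
    unfolding tendsto_PInfty eventually_sequentially by blast
  with v(1)[of n] show False by simp
qed

text \<open>
  The dichotomy behind the boundedness of the iterates.  The threshold \<open>2 * s\<close> is the one beyond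
  which the decrease \<open>L / 2 * (norm d)\<^sup>2\<close> outweighs the possible increase \<open>s * norm d\<close> caused by
  the gradient error.
\<close>

lemma inexact_prox_gradient_step:
  fixes f :: "'a::real_inner \<Rightarrow> real"
  assumes grad: "\<And>z. GDERIV f z :> gradf z"
    and L: "0 < L"
    and lip: "\<And>y z. norm (gradf y - gradf z) \<le> L * norm (y - z)"
    and conv: "ext_convex r"
    and fin: "composite f r a < \<infinity>"
    and prox: "is_prox (1 / L) r (a - (1 / L) *\<^sub>R g) b"
    and err: "norm (gradf a - g) \<le> s"
  shows "composite f r b \<le> composite f r a
    \<or> (\<exists>u\<in>composite_subdiff gradf r b. norm u \<le> 5 * s)"
proof -
  define d where "d = b - a"
  define u where "u = - (L *\<^sub>R d) - g"
  have ra: "r a < \<infinity>" using fin by (auto simp: composite_def)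
  have u_eq: "(1 / (1 / L)) *\<^sub>R (a - (1 / L) *\<^sub>R g - b) = u"
    using L by (simp add: u_def d_def algebra_simps)
  have u: "u \<in> subdiff r b"
    using prox_residual_in_subdiff[OF conv _ prox ra] L unfolding u_eq by simp
  show ?thesis
  proof (cases "2 * s \<le> L * norm d")
    case True
    obtain ra' where ra': "r a = ereal ra'"
      using ra conv by (cases "r a") (auto simp: ext_convex_def)
    obtain rb where rb: "r b = ereal rb"
      using is_prox_finite[OF conv _ prox ra] L by auto
    have "rb + u \<bullet> (a - b) \<le> ra'"
      using u by (auto simp: subdiff_def ra' rb dest!: spec[of _ a])
    moreover have "u \<bullet> (a - b) = L * (norm d)\<^sup>2 + g \<bullet> d"
      by (simp add: u_def d_def power2_norm_eq_inner algebra_simps)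
    moreover have "f b \<le> f a + gradf a \<bullet> d + L / 2 * (norm d)\<^sup>2"
      unfolding d_def by (rule descent_inequality[OF grad lip])
    moreover have "gradf a \<bullet> d - g \<bullet> d \<le> L / 2 * (norm d)\<^sup>2"
    proof -
      have "(gradf a - g) \<bullet> d \<le> norm (gradf a - g) * norm d"
        by (rule norm_cauchy_schwarz)
      also have "\<dots> \<le> (L * norm d / 2) * norm d"
        using err True by (intro mult_right_mono) auto
      finally show ?thesis by (simp add: inner_diff_left power2_eq_square)
    qed
    ultimately have "f b + rb \<le> f a + ra'" by linarith
    then show ?thesis by (simp add: composite_def ra' rb)
  next
    case False
    have eq: "gradf b + u = (gradf b - gradf a) + (gradf a - g) - L *\<^sub>R d"
      by (simp add: u_def algebra_simps)
    have "norm (gradf b + u) \<le> norm (gradf b - gradf a) + norm (gradf a - g) + norm (L *\<^sub>R d)"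
      unfolding eq using norm_triangle_ineq4[of "(gradf b - gradf a) + (gradf a - g)" "L *\<^sub>R d"]
        norm_triangle_ineq[of "gradf b - gradf a" "gradf a - g"] by linarith
    also have "\<dots> \<le> L * norm d + s + L * norm d"
      using lip[of b a] err L by (simp add: d_def)
    finally have "norm (gradf b + u) \<le> 5 * s" using False by simp
    then show ?thesis using u by (auto simp: composite_subdiff_def)
  qed
qed

theorem proposition5p2:
  fixes f :: "real ^ 'n \<Rightarrow> real"
    and gradf :: "real ^ 'n \<Rightarrow> real ^ 'n"
    and r F :: "real ^ 'n \<Rightarrow> ereal"
    and P :: "real ^ 'n \<Rightarrow> real ^ 'n"
    and x g :: "nat \<Rightarrow> real ^ 'n"
    and L \<alpha> \<epsilon>_abs :: real
  assumes f_diff: "\<And>z. GDERIV f z :> gradf z"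
    and L_pos: "L > 0"
    and gradf_lipschitz: "\<And>y z. norm (gradf y - gradf z) \<le> L * norm (y - z)"
    and r_convex: "ext_convex r"
    and F_def: "F = composite f r"
    and solutions: "solution_set F \<noteq> {}"
    and P_nearest: "nearest_point_map (solution_set F) P"
    and F_coercive: "coercive_wrt P F"
    and dF_coercive: "subdiff_coercive (composite_subdiff gradf r) F"
    and alpha: "\<alpha> = 1 / L"
    and x0: "F (x 0) < \<infinity>"
    and step: "\<And>k. is_prox \<alpha> r (x k - \<alpha> *\<^sub>R g k) (x (Suc k))"
    and eps: "\<epsilon>_abs \<ge> 0"
    and grad_error: "\<And>k. (norm (gradf (x k) - g k))\<^sup>2 \<le> \<epsilon>_abs"
  shows "\<exists>R>0. \<forall>k. norm (x k - P (x k)) \<le> R"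
proof -
  obtain M where M: "\<And>v. \<exists>u\<in>composite_subdiff gradf r v. norm u \<le> 5 * sqrt \<epsilon>_abs \<Longrightarrow> F v \<le> ereal M"
    using subdiff_coercive_imp_bounded_value[OF dF_coercive] by metis
  obtain C where C: "F (x 0) \<le> ereal C"
    using x0 by (cases "F (x 0)") auto
  have bound: "F (x k) \<le> ereal (max C M)" for k
  proof (induction k)
    case 0
    then show ?case using C by (rule order_trans) simp
  next
    case (Suc k)
    have "composite f r (x k) < \<infinity>"
      using Suc unfolding F_def by (rule le_less_trans) (simp add: max_def)
    moreover have "norm (gradf (x k) - g k) \<le> sqrt \<epsilon>_abs"
      using grad_error by (rule real_le_rsqrt)
    ultimately have "F (x (Suc k)) \<le> F (x k)
        \<or> (\<exists>u\<in>composite_subdiff gradf r (x (Suc k)). norm u \<le> 5 * sqrt \<epsilon>_abs)"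
      unfolding F_def
      using inexact_prox_gradient_step[OF f_diff L_pos gradf_lipschitz r_convex] step[of k] alpha
      by blast
    then show ?case
    proof
      assume "F (x (Suc k)) \<le> F (x k)"
      then show ?thesis using Suc by (rule order_trans)
    next
      assume "\<exists>u\<in>composite_subdiff gradf r (x (Suc k)). norm u \<le> 5 * sqrt \<epsilon>_abs"
      from M[OF this] show ?thesis by (rule order_trans) simp
    qed
  qed
  obtain R where "R > 0" "\<And>v. F v \<le> ereal (max C M) \<Longrightarrow> norm (v - P v) \<le> R"
    using coercive_wrt_imp_bounded_distance[OF F_coercive] by metis
  with bound show ?thesis by blast
qed

end
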